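(* Let $(S,\cdot)$ be a semigroup satisfying the Strong F\o lner Condition, let $\sim$ be the relation on $S$ given by $a\sim b$ iff there exists $x\in S$ with $ax=bx$, and let $T=S/\!\sim$. Assume that $T$ is finite. Then: (1) $T$ is a finite group; (2) $T$ is the unique minimal left ideal of $\beta T$; (3) the minimal left ideals of $\beta S$ are isomorphic to $T$; (4) $\beta S$ has a unique minimal right ideal; (5) $T=K(\beta T)=\Delta(T)$.
   Context: $S$ satisfies the Strong F\o lner Condition (SFC) if for every finite nonempty $H\subseteq S$ and $\epsilon>0$ there is a finite nonempty $K\subseteq S$ with $|K\setminus sK|<\epsilon|K|$ for all $s\in H$. Under SFC, $\sim$ is a congruence and $T$ is a cancellative semigroup satisfying SFC. $\beta S$ is the set of ultrafilters on $S$ with operation extending that of $S$ given by: $A\in pq$ iff $\{s\in S:s^{-1}A\in q\}\in p$, $s^{-1}A=\{t:st\in A\}$ (for finite $T$, $\beta T=T$). $K(\beta T)$ is the smallest two sided ideal. For $A\subseteq T$, $d(A)$ is the supremum of $\alpha\in[0,1]$ such that for every finite nonempty $H\subseteq T$, $\epsilon>0$ there is a finite nonempty $K\subseteq T$ with $|K\setminus sK|<\epsilon|K|$ for all $s\in H$ and $|A\cap K|\ge\alpha|K|$; $\Delta(T)=\{p\in\beta T:d(A)>0$ for all $A\in p\}$. *)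

theory Defs
  imports Complex_Main "HOL-Algebra.Group"
begin

text \<open>Semigroups are structures of type \<^typ>\<open>('a, 'b) monoid_scheme\<close>, of which only the fields
  \<^const>\<open>carrier\<close> and \<^const>\<open>mult\<close> matter; this gives access to \<^const>\<open>iso\<close> and \<^const>\<open>group\<close>
  of HOL-Algebra. The field \<^const>\<open>one\<close> carries no information: it is left \<^const>\<open>undefined\<close> in the
  structures built here and no definition reads it.\<close>

definition is_semigroup :: "('a, 'b) monoid_scheme \<Rightarrow> bool" where
  "is_semigroup S \<longleftrightarrow>
     carrier S \<noteq> {} \<and>
     (\<forall>x\<in>carrier S. \<forall>y\<in>carrier S. x \<otimes>\<^bsub>S\<^esub> y \<in> carrier S) \<and>
     (\<forall>x\<in>carrier S. \<forall>y\<in>carrier S. \<forall>z\<in>carrier S.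
        (x \<otimes>\<^bsub>S\<^esub> y) \<otimes>\<^bsub>S\<^esub> z = x \<otimes>\<^bsub>S\<^esub> (y \<otimes>\<^bsub>S\<^esub> z))"

definition folner_set ::
  "('a, 'b) monoid_scheme \<Rightarrow> 'a set \<Rightarrow> real \<Rightarrow> 'a set \<Rightarrow> bool" where
  "folner_set S H \<epsilon> K \<longleftrightarrow>
     finite K \<and> K \<noteq> {} \<and> K \<subseteq> carrier S \<and>
     (\<forall>s\<in>H. real (card (K - (\<lambda>k. s \<otimes>\<^bsub>S\<^esub> k) ` K)) < \<epsilon> * real (card K))"

definition SFC :: "('a, 'b) monoid_scheme \<Rightarrow> bool" where
  "SFC S \<longleftrightarrow>
     (\<forall>H \<epsilon>. finite H \<and> H \<noteq> {} \<and> H \<subseteq> carrier S \<and> \<epsilon> > 0 \<longrightarrow> (\<exists>K. folner_set S H \<epsilon> K))"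

definition folner_density :: "('a, 'b) monoid_scheme \<Rightarrow> 'a set \<Rightarrow> real" where
  "folner_density S A =
     Sup {\<alpha>. 0 \<le> \<alpha> \<and> \<alpha> \<le> 1 \<and>
       (\<forall>H \<epsilon>. finite H \<and> H \<noteq> {} \<and> H \<subseteq> carrier S \<and> \<epsilon> > 0 \<longrightarrow>
          (\<exists>K. folner_set S H \<epsilon> K \<and> real (card (A \<inter> K)) \<ge> \<alpha> * real (card K)))}"

definition cancel_rel :: "('a, 'b) monoid_scheme \<Rightarrow> ('a \<times> 'a) set" where
  "cancel_rel S =
     {(a, b). a \<in> carrier S \<and> b \<in> carrier S \<and> (\<exists>x\<in>carrier S. a \<otimes>\<^bsub>S\<^esub> x = b \<otimes>\<^bsub>S\<^esub> x)}"

text \<open>The product of two classes is the class of the product of any representatives; the union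
  collapses to a single class because \<^const>\<open>cancel_rel\<close> is a congruence under \<^const>\<open>SFC\<close>
  (lemmas \<open>equiv_cancel_rel\<close> and \<open>congruent2_cancel_rel\<close> below).\<close>

definition cancel_quotient :: "('a, 'b) monoid_scheme \<Rightarrow> 'a set monoid" where
  "cancel_quotient S =
     \<lparr>carrier = carrier S // cancel_rel S,
      mult = (\<lambda>A B. \<Union>a\<in>A. \<Union>b\<in>B. cancel_rel S `` {a \<otimes>\<^bsub>S\<^esub> b}),
      one = undefined\<rparr>"

definition ultrafilter_on :: "'a set \<Rightarrow> 'a set set \<Rightarrow> bool" where
  "ultrafilter_on X p \<longleftrightarrow>
     p \<subseteq> Pow X \<and> X \<in> p \<and> {} \<notin> p \<and>
     (\<forall>A\<in>p. \<forall>B\<in>p. A \<inter> B \<in> p) \<and>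
     (\<forall>A\<in>p. \<forall>B. A \<subseteq> B \<and> B \<subseteq> X \<longrightarrow> B \<in> p) \<and>
     (\<forall>A. A \<subseteq> X \<longrightarrow> A \<in> p \<or> X - A \<in> p)"

definition beta :: "('a, 'b) monoid_scheme \<Rightarrow> 'a set set monoid" where
  "beta S =
     \<lparr>carrier = {p. ultrafilter_on (carrier S) p},
      mult = (\<lambda>p q. {A. A \<subseteq> carrier S \<and>
                {s \<in> carrier S. {t \<in> carrier S. s \<otimes>\<^bsub>S\<^esub> t \<in> A} \<in> q} \<in> p}),
      one = undefined\<rparr>"

text \<open>The principal ultrafilters, i.e. the canonical copy of a semigroup inside its
  \<^const>\<open>beta\<close>.\<close>

definition principal_ultrafilter :: "'a set \<Rightarrow> 'a \<Rightarrow> 'a set set" where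
  "principal_ultrafilter X x = {A. A \<subseteq> X \<and> x \<in> A}"

definition embedded :: "('a, 'b) monoid_scheme \<Rightarrow> 'a set set set" where
  "embedded S = principal_ultrafilter (carrier S) ` carrier S"

definition Delta :: "('a, 'b) monoid_scheme \<Rightarrow> 'a set set set" where
  "Delta S = {p \<in> carrier (beta S). \<forall>A\<in>p. folner_density S A > 0}"

definition left_ideal :: "('a, 'b) monoid_scheme \<Rightarrow> 'a set \<Rightarrow> bool" where
  "left_ideal S I \<longleftrightarrow>
     I \<noteq> {} \<and> I \<subseteq> carrier S \<and> (\<forall>s\<in>carrier S. \<forall>x\<in>I. s \<otimes>\<^bsub>S\<^esub> x \<in> I)"

definition right_ideal :: "('a, 'b) monoid_scheme \<Rightarrow> 'a set \<Rightarrow> bool" where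
  "right_ideal S I \<longleftrightarrow>
     I \<noteq> {} \<and> I \<subseteq> carrier S \<and> (\<forall>s\<in>carrier S. \<forall>x\<in>I. x \<otimes>\<^bsub>S\<^esub> s \<in> I)"

definition two_sided_ideal :: "('a, 'b) monoid_scheme \<Rightarrow> 'a set \<Rightarrow> bool" where
  "two_sided_ideal S I \<longleftrightarrow> left_ideal S I \<and> right_ideal S I"

definition minimal_left_ideal :: "('a, 'b) monoid_scheme \<Rightarrow> 'a set \<Rightarrow> bool" where
  "minimal_left_ideal S L \<longleftrightarrow> left_ideal S L \<and> (\<forall>I. left_ideal S I \<and> I \<subseteq> L \<longrightarrow> I = L)"

definition minimal_right_ideal :: "('a, 'b) monoid_scheme \<Rightarrow> 'a set \<Rightarrow> bool" where
  "minimal_right_ideal S R \<longleftrightarrow> right_ideal S R \<and> (\<forall>I. right_ideal S I \<and> I \<subseteq> R \<longrightarrow> I = R)"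

text \<open>A predicate rather than a choice operator, so that \<^term>\<open>is_smallest_ideal S K\<close> asserts both
  that a smallest two-sided ideal exists and that it equals \<^term>\<open>K\<close>.\<close>

definition is_smallest_ideal :: "('a, 'b) monoid_scheme \<Rightarrow> 'a set \<Rightarrow> bool" where
  "is_smallest_ideal S K \<longleftrightarrow> two_sided_ideal S K \<and> (\<forall>I. two_sided_ideal S I \<longrightarrow> K \<subseteq> I)"

definition subsemigroup_on :: "('a, 'b) monoid_scheme \<Rightarrow> 'a set \<Rightarrow> ('a, 'b) monoid_scheme" where
  "subsemigroup_on S L = S\<lparr>carrier := L\<rparr>"

lemma SFC_common_right_multiple:
  assumes "is_semigroup S" "SFC S" and a: "a \<in> carrier S" and b: "b \<in> carrier S"
  obtains u v where "u \<in> carrier S" "v \<in> carrier S" "a \<otimes>\<^bsub>S\<^esub> u = b \<otimes>\<^bsub>S\<^esub> v"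
proof -
  have "\<exists>K. folner_set S {a, b} (1/2) K"
    using assms unfolding SFC_def by simp
  then obtain K where K: "finite K" "K \<noteq> {}" "K \<subseteq> carrier S"
    and ka: "real (card (K - (\<lambda>k. a \<otimes>\<^bsub>S\<^esub> k) ` K)) < 1/2 * real (card K)"
    and kb: "real (card (K - (\<lambda>k. b \<otimes>\<^bsub>S\<^esub> k) ` K)) < 1/2 * real (card K)"
    unfolding folner_set_def by blast
  let ?A = "K - (\<lambda>k. a \<otimes>\<^bsub>S\<^esub> k) ` K" and ?B = "K - (\<lambda>k. b \<otimes>\<^bsub>S\<^esub> k) ` K"
  have "card (?A \<union> ?B) \<le> card ?A + card ?B" by (rule card_Un_le)
  with ka kb have "card (?A \<union> ?B) < card K" by linarith
  then have "?A \<union> ?B \<noteq> K" by auto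
  then obtain k where "k \<in> K" "k \<in> (\<lambda>k. a \<otimes>\<^bsub>S\<^esub> k) ` K" "k \<in> (\<lambda>k. b \<otimes>\<^bsub>S\<^esub> k) ` K" by blast
  then obtain u v where "u \<in> K" "v \<in> K" "a \<otimes>\<^bsub>S\<^esub> u = b \<otimes>\<^bsub>S\<^esub> v" by auto
  with K(3) that show thesis by blast
qed

lemma equiv_cancel_rel:
  assumes S: "is_semigroup S" "SFC S"
  shows "equiv (carrier S) (cancel_rel S)"
proof (rule equivI)
  show "cancel_rel S \<subseteq> carrier S \<times> carrier S" unfolding cancel_rel_def by blast
  show "refl_on (carrier S) (cancel_rel S)"
    using S(1) unfolding refl_on_def cancel_rel_def is_semigroup_def by blast
  show "sym (cancel_rel S)" unfolding sym_def cancel_rel_def by auto metis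
  show "trans (cancel_rel S)"
  proof (rule transI)
    fix a b c assume "(a, b) \<in> cancel_rel S" "(b, c) \<in> cancel_rel S"
    then obtain x y where c: "a \<in> carrier S" "b \<in> carrier S" "c \<in> carrier S"
      "x \<in> carrier S" "y \<in> carrier S"
      and x: "a \<otimes>\<^bsub>S\<^esub> x = b \<otimes>\<^bsub>S\<^esub> x" and y: "b \<otimes>\<^bsub>S\<^esub> y = c \<otimes>\<^bsub>S\<^esub> y"
      unfolding cancel_rel_def by blast
    obtain u v where uv: "u \<in> carrier S" "v \<in> carrier S" "x \<otimes>\<^bsub>S\<^esub> u = y \<otimes>\<^bsub>S\<^esub> v"
      using SFC_common_right_multiple[OF S c(4,5)] .
    have "a \<otimes>\<^bsub>S\<^esub> (x \<otimes>\<^bsub>S\<^esub> u) = c \<otimes>\<^bsub>S\<^esub> (x \<otimes>\<^bsub>S\<^esub> u)"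
      using S(1) c x y uv unfolding is_semigroup_def by metis
    moreover have "x \<otimes>\<^bsub>S\<^esub> u \<in> carrier S" using S(1) c uv unfolding is_semigroup_def by blast
    ultimately show "(a, c) \<in> cancel_rel S" using c unfolding cancel_rel_def by blast
  qed
qed

lemma congruent2_cancel_rel:
  assumes S: "is_semigroup S" "SFC S"
  shows "congruent2 (cancel_rel S) (cancel_rel S) (\<lambda>a b. cancel_rel S `` {a \<otimes>\<^bsub>S\<^esub> b})"
proof (rule congruent2I')
  fix a a' b b' assume "(a, a') \<in> cancel_rel S" "(b, b') \<in> cancel_rel S"
  then obtain x y where c: "a \<in> carrier S" "a' \<in> carrier S" "b \<in> carrier S" "b' \<in> carrier S"
    "x \<in> carrier S" "y \<in> carrier S"
    and x: "a \<otimes>\<^bsub>S\<^esub> x = a' \<otimes>\<^bsub>S\<^esub> x" and y: "b \<otimes>\<^bsub>S\<^esub> y = b' \<otimes>\<^bsub>S\<^esub> y"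
    unfolding cancel_rel_def by blast
  have cl: "\<And>s t. s \<in> carrier S \<Longrightarrow> t \<in> carrier S \<Longrightarrow> s \<otimes>\<^bsub>S\<^esub> t \<in> carrier S"
    and as: "\<And>r s t. r \<in> carrier S \<Longrightarrow> s \<in> carrier S \<Longrightarrow> t \<in> carrier S \<Longrightarrow>
      (r \<otimes>\<^bsub>S\<^esub> s) \<otimes>\<^bsub>S\<^esub> t = r \<otimes>\<^bsub>S\<^esub> (s \<otimes>\<^bsub>S\<^esub> t)"
    using S(1) unfolding is_semigroup_def by blast+
  have by_in: "b \<otimes>\<^bsub>S\<^esub> y \<in> carrier S" using cl c by blast
  obtain u v where uv: "u \<in> carrier S" "v \<in> carrier S" "x \<otimes>\<^bsub>S\<^esub> u = (b \<otimes>\<^bsub>S\<^esub> y) \<otimes>\<^bsub>S\<^esub> v"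
    using SFC_common_right_multiple[OF S c(5) by_in] .
  have "(a \<otimes>\<^bsub>S\<^esub> b) \<otimes>\<^bsub>S\<^esub> (y \<otimes>\<^bsub>S\<^esub> v) = a \<otimes>\<^bsub>S\<^esub> (x \<otimes>\<^bsub>S\<^esub> u)"
    using c uv by (simp add: as cl)
  also have "\<dots> = a' \<otimes>\<^bsub>S\<^esub> (x \<otimes>\<^bsub>S\<^esub> u)" using as[of a x u] as[of a' x u] x c uv by simp
  also have "\<dots> = a' \<otimes>\<^bsub>S\<^esub> ((b' \<otimes>\<^bsub>S\<^esub> y) \<otimes>\<^bsub>S\<^esub> v)" using uv(3) y by simp
  also have "\<dots> = (a' \<otimes>\<^bsub>S\<^esub> b') \<otimes>\<^bsub>S\<^esub> (y \<otimes>\<^bsub>S\<^esub> v)" using c uv by (simp add: as cl)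
  finally have "(a \<otimes>\<^bsub>S\<^esub> b, a' \<otimes>\<^bsub>S\<^esub> b') \<in> cancel_rel S"
    using c uv cl unfolding cancel_rel_def by blast
  then show "cancel_rel S `` {a \<otimes>\<^bsub>S\<^esub> b} = cancel_rel S `` {a' \<otimes>\<^bsub>S\<^esub> b'}"
    by (rule equiv_class_eq[OF equiv_cancel_rel[OF S]])
qed

end

theory Submission
  imports Defs
begin

text \<open>Any two right ideals of \<open>S\<close> meet, because any two elements have a common right multiple. A
  finite right cancellative semigroup with common right multiples is a group, so \<open>T\<close> is one, and
  everything about \<open>\<beta>T\<close> follows since \<open>\<beta>T = T\<close>. For \<open>\<beta>S\<close>, let \<open>Q\<close> be the set of
  ultrafilters containing every right ideal of \<open>S\<close>; it is nonempty and is a right ideal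
  of \<open>\<beta>S\<close>. For \<open>q \<in> Q\<close> the product \<open>pq\<close> depends only on the class in \<open>T\<close> to
  which \<open>p\<close> converges: if \<open>ax = bx\<close>, then the right ideal \<open>{x. ax = bx}\<close> belongs to \<open>q\<close>.
  Hence \<open>\<beta>S q\<close> is a minimal left ideal isomorphic to \<open>T\<close>, every minimal left ideal has this form
  (if \<open>p \<in> L\<close>, then \<open>qp \<in> L \<inter> Q\<close>), and \<open>\<beta>S Q\<close> is the smallest right ideal.\<close>

section \<open>Ultrafilters\<close>

text \<open>The clauses of \<open>ultrafilter_on\<close> without the one deciding every subset of
  \<open>X\<close>; these are the objects that Zorn's lemma ranges over.\<close>

definition filter_on :: "'a set \<Rightarrow> 'a set set \<Rightarrow> bool" where
  "filter_on X p \<longleftrightarrow>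
     p \<subseteq> Pow X \<and> X \<in> p \<and> {} \<notin> p \<and>
     (\<forall>A\<in>p. \<forall>B\<in>p. A \<inter> B \<in> p) \<and>
     (\<forall>A\<in>p. \<forall>B. A \<subseteq> B \<and> B \<subseteq> X \<longrightarrow> B \<in> p)"

lemma filter_on_Union_chain:
  assumes "\<And>p. p \<in> C \<Longrightarrow> filter_on X p" and "C \<noteq> {}"
    and chain: "\<And>p q. p \<in> C \<Longrightarrow> q \<in> C \<Longrightarrow> p \<subseteq> q \<or> q \<subseteq> p"
  shows "filter_on X (\<Union>C)"
  unfolding filter_on_def
proof (intro conjI ballI allI impI)
  fix A B assume "A \<in> \<Union>C" "B \<in> \<Union>C"
  then obtain p q where "A \<in> p" "p \<in> C" "B \<in> q" "q \<in> C" by blast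
  with chain[of p q] obtain r where "r \<in> C" "A \<in> r" "B \<in> r" by blast
  with assms(1) show "A \<inter> B \<in> \<Union>C" unfolding filter_on_def by blast
next
  show "\<Union>C \<subseteq> Pow X" "{} \<notin> \<Union>C" using assms(1) unfolding filter_on_def by blast+
  show "X \<in> \<Union>C" using assms(1,2) unfolding filter_on_def by blast
  fix A B assume "A \<in> \<Union>C" "A \<subseteq> B \<and> B \<subseteq> X"
  then show "B \<in> \<Union>C" using assms(1) unfolding filter_on_def by blast
qed

text \<open>Zorn's lemma gives a maximal filter \<open>M\<close> above \<open>F\<close>. If
  \<open>M\<close> has a member disjoint from \<open>A\<close>, then \<open>X - A\<close> belongs to
  \<open>M\<close>; otherwise \<open>A\<close> can be adjoined to \<open>M\<close>, so by maximality
  it is already there.\<close>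

lemma filter_on_extends_to_ultrafilter:
  assumes "filter_on X F"
  obtains p where "ultrafilter_on X p" "F \<subseteq> p"
proof -
  let ?P = "{p. filter_on X p \<and> F \<subseteq> p}"
  have "\<exists>M\<in>?P. \<forall>p\<in>?P. M \<subseteq> p \<longrightarrow> p = M"
  proof (rule subset_Zorn_nonempty)
    show "?P \<noteq> {}" using assms by blast
    fix C assume C: "C \<noteq> {}" "subset.chain ?P C"
    then have "filter_on X (\<Union>C)"
      by (intro filter_on_Union_chain) (use subset_chain_def[of ?P C] in blast)+
    moreover have "F \<subseteq> \<Union>C" using C unfolding subset_chain_def by blast
    ultimately show "\<Union>C \<in> ?P" by blast
  qed
  then obtain M where M: "filter_on X M" "F \<subseteq> M" and "\<forall>p\<in>?P. M \<subseteq> p \<longrightarrow> p = M"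
    by auto
  then have max: "p = M" if "filter_on X p" "M \<subseteq> p" for p
    using that order_trans[OF \<open>F \<subseteq> M\<close>] by simp
  have "A \<in> M \<or> X - A \<in> M" if A: "A \<subseteq> X" for A
  proof (cases "\<exists>B\<in>M. A \<inter> B = {}")
    case True
    then obtain B where B: "B \<in> M" "A \<inter> B = {}" by blast
    then have "B \<subseteq> X - A" using M(1) unfolding filter_on_def by blast
    then show ?thesis using B(1) M(1) unfolding filter_on_def by blast
  next
    case False
    \<comment> \<open>The filter generated by \<open>M\<close> and \<open>A\<close>. It omits the
      empty set exactly because every member of \<open>M\<close> meets \<open>A\<close>.\<close>
    let ?N = "{D. D \<subseteq> X \<and> (\<exists>B\<in>M. A \<inter> B \<subseteq> D)}"
    have "filter_on X ?N"
      unfolding filter_on_def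
    proof (intro conjI ballI allI impI)
      fix D E assume "D \<in> ?N" "E \<in> ?N"
      then obtain B B' where B: "B \<in> M" "B' \<in> M" "A \<inter> B \<subseteq> D" "A \<inter> B' \<subseteq> E" "D \<subseteq> X" by blast
      then have "B \<inter> B' \<in> M" using M(1) unfolding filter_on_def by blast
      moreover have "A \<inter> (B \<inter> B') \<subseteq> D \<inter> E" using B by blast
      ultimately show "D \<inter> E \<in> ?N" using B by blast
    next
      show "X \<in> ?N" using M(1) A unfolding filter_on_def by blast
      show "{} \<notin> ?N" using False by blast
    qed blast+
    moreover have "M \<subseteq> ?N" using M(1) unfolding filter_on_def by blast
    ultimately have "?N = M" by (rule max)
    moreover have "A \<in> ?N" using A M(1) unfolding filter_on_def by blast
    ultimately show ?thesis by blast
  qed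
  with M have "ultrafilter_on X M" unfolding filter_on_def ultrafilter_on_def by blast
  with M(2) that show thesis by blast
qed

lemma ultrafilter_onD:
  assumes "ultrafilter_on X p"
  shows "A \<in> p \<Longrightarrow> A \<subseteq> X" "X \<in> p" "{} \<notin> p"
    "A \<in> p \<Longrightarrow> B \<in> p \<Longrightarrow> A \<inter> B \<in> p"
    "A \<in> p \<Longrightarrow> A \<subseteq> B \<Longrightarrow> B \<subseteq> X \<Longrightarrow> B \<in> p"
    "A \<subseteq> X \<Longrightarrow> A \<notin> p \<Longrightarrow> X - A \<in> p"
  using assms unfolding ultrafilter_on_def by blast+

lemma ultrafilter_on_Int_iff:
  assumes "ultrafilter_on X p" "A \<subseteq> X" "B \<subseteq> X"
  shows "A \<inter> B \<in> p \<longleftrightarrow> A \<in> p \<and> B \<in> p"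
  using ultrafilter_onD(4)[OF assms(1), of A B] ultrafilter_onD(5)[OF assms(1), of "A \<inter> B" A]
    ultrafilter_onD(5)[OF assms(1), of "A \<inter> B" B] assms(2,3)
  by blast

lemma ultrafilter_on_Diff_iff:
  assumes "ultrafilter_on X p" "A \<subseteq> X"
  shows "X - A \<in> p \<longleftrightarrow> A \<notin> p"
  using ultrafilter_onD(3)[OF assms(1)] ultrafilter_onD(6)[OF assms]
    ultrafilter_onD(4)[OF assms(1), of A "X - A"]
  by auto

text \<open>Ultrafilters are maximal: a set in \<open>q\<close> but not in \<open>p\<close> would
  have its complement in \<open>p\<close>, hence in \<open>q\<close>.\<close>

lemma ultrafilter_on_eqI:
  assumes p: "ultrafilter_on X p" and q: "ultrafilter_on X q" and "p \<subseteq> q"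
  shows "p = q"
proof
  show "q \<subseteq> p"
  proof
    fix A assume "A \<in> q"
    then show "A \<in> p"
      using ultrafilter_onD(1)[OF q] ultrafilter_on_Diff_iff[OF p, of A]
        ultrafilter_on_Diff_iff[OF q, of A] \<open>p \<subseteq> q\<close> by blast
  qed
qed fact

text \<open>Serves to select a part of a finite partition: a point of a finite set, and later a
  class of the finite quotient.\<close>

lemma ultrafilter_on_finite_Union:
  assumes "ultrafilter_on X p" and "finite C" and "\<Union>C \<in> p"
  shows "\<exists>A\<in>C. A \<in> p"
  using assms(2,3)
proof (induction C rule: finite_induct)
  case empty
  then show ?case using ultrafilter_onD(3)[OF assms(1)] by simp
next
  case (insert A C)
  have X: "A \<subseteq> X" "\<Union>C \<subseteq> X" using ultrafilter_onD(1)[OF assms(1) insert.prems] by auto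
  show ?case
  proof (cases "A \<in> p")
    case False
    then have "X - A \<in> p" using ultrafilter_onD(6)[OF assms(1) X(1)] by blast
    then have "(A \<union> \<Union>C) \<inter> (X - A) \<in> p"
      using ultrafilter_onD(4)[OF assms(1)] insert.prems by simp
    then have "\<Union>C \<in> p" using ultrafilter_onD(5)[OF assms(1)] X by blast
    then show ?thesis using insert.IH by blast
  qed blast
qed

lemma ultrafilter_on_principal: "x \<in> X \<Longrightarrow> ultrafilter_on X (principal_ultrafilter X x)"
  unfolding ultrafilter_on_def principal_ultrafilter_def by auto

lemma ultrafilter_on_finite_principal:
  assumes p: "ultrafilter_on X p" and "finite X"
  shows "\<exists>x\<in>X. p = principal_ultrafilter X x"
proof -
  have "\<Union>((\<lambda>x. {x}) ` X) \<in> p" using ultrafilter_onD(2)[OF p] by simp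
  then obtain x where x: "x \<in> X" "{x} \<in> p"
    using ultrafilter_on_finite_Union[OF p, of "(\<lambda>x. {x}) ` X"] \<open>finite X\<close> by auto
  have "principal_ultrafilter X x \<subseteq> p"
    using ultrafilter_onD(5)[OF p x(2)] unfolding principal_ultrafilter_def by blast
  then show ?thesis
    using ultrafilter_on_eqI[OF ultrafilter_on_principal[OF x(1)] p] x(1) by blast
qed

section \<open>The semigroup of ultrafilters\<close>

lemma is_semigroupD:
  assumes "is_semigroup M"
  shows "carrier M \<noteq> {}"
    "x \<in> carrier M \<Longrightarrow> y \<in> carrier M \<Longrightarrow> x \<otimes>\<^bsub>M\<^esub> y \<in> carrier M"
    "x \<in> carrier M \<Longrightarrow> y \<in> carrier M \<Longrightarrow> z \<in> carrier M \<Longrightarrow>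
      (x \<otimes>\<^bsub>M\<^esub> y) \<otimes>\<^bsub>M\<^esub> z = x \<otimes>\<^bsub>M\<^esub> (y \<otimes>\<^bsub>M\<^esub> z)"
  using assms unfolding is_semigroup_def by blast+

lemma beta_carrier_iff [simp]: "p \<in> carrier (beta M) \<longleftrightarrow> ultrafilter_on (carrier M) p"
  by (simp add: beta_def)

lemma beta_mult_iff:
  "A \<in> p \<otimes>\<^bsub>beta M\<^esub> q \<longleftrightarrow>
    A \<subseteq> carrier M \<and> {s \<in> carrier M. {t \<in> carrier M. s \<otimes>\<^bsub>M\<^esub> t \<in> A} \<in> q} \<in> p"
  by (simp add: beta_def)

text \<open>The product is the preimage of \<open>p\<close> under \<open>D\<close>. Since
  \<open>q\<close> is an ultrafilter, \<open>D\<close> commutes with intersections and complements,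
  so the ultrafilter laws pull back along it.\<close>

lemma beta_mult_closed:
  assumes "is_semigroup M" and p: "ultrafilter_on (carrier M) p"
    and q: "ultrafilter_on (carrier M) q"
  shows "ultrafilter_on (carrier M) (p \<otimes>\<^bsub>beta M\<^esub> q)"
proof -
  let ?X = "carrier M"
  define D where "D A = {s \<in> ?X. {t \<in> ?X. s \<otimes>\<^bsub>M\<^esub> t \<in> A} \<in> q}" for A
  note cl = is_semigroupD(2)[OF assms(1)]
  have D_sub: "D A \<subseteq> ?X" for A unfolding D_def by blast
  have D_carrier: "D ?X = ?X"
  proof -
    have "{t \<in> ?X. s \<otimes>\<^bsub>M\<^esub> t \<in> ?X} = ?X" if "s \<in> ?X" for s using cl that by blast
    then show ?thesis unfolding D_def using ultrafilter_onD(2)[OF q] by auto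
  qed
  have D_Int: "D (A \<inter> B) = D A \<inter> D B" for A B
  proof -
    have "{t \<in> ?X. s \<otimes>\<^bsub>M\<^esub> t \<in> A \<inter> B} = {t \<in> ?X. s \<otimes>\<^bsub>M\<^esub> t \<in> A} \<inter> {t \<in> ?X. s \<otimes>\<^bsub>M\<^esub> t \<in> B}" for s
      by blast
    then show ?thesis unfolding D_def using ultrafilter_on_Int_iff[OF q] by auto
  qed
  have D_Diff: "D (?X - A) = ?X - D A" for A
  proof -
    have "{t \<in> ?X. s \<otimes>\<^bsub>M\<^esub> t \<in> ?X - A} = ?X - {t \<in> ?X. s \<otimes>\<^bsub>M\<^esub> t \<in> A}" if "s \<in> ?X" for s
      using cl that by blast
    then show ?thesis unfolding D_def using ultrafilter_on_Diff_iff[OF q] by auto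
  qed
  have D_empty: "D {} = {}" using D_Diff[of ?X] D_carrier by simp
  have iff: "A \<in> p \<otimes>\<^bsub>beta M\<^esub> q \<longleftrightarrow> A \<subseteq> ?X \<and> D A \<in> p" for A
    unfolding beta_mult_iff D_def by blast
  show ?thesis
    unfolding ultrafilter_on_def iff
  proof (intro conjI ballI allI impI)
    fix A B assume "A \<in> p \<otimes>\<^bsub>beta M\<^esub> q" "A \<subseteq> B \<and> B \<subseteq> ?X"
    \<comment> \<open>Monotonicity of \<open>D\<close> is read off from \<open>D_Int\<close>,
      because \<open>A \<inter> B = A\<close>.\<close>
    then have "D A \<in> p" "D A = D A \<inter> D B" unfolding iff D_Int[symmetric] by (auto simp: Int_absorb2)
    then show "D B \<in> p" using ultrafilter_onD(5)[OF p] D_sub by blast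
  next
    fix A assume "A \<subseteq> ?X"
    show "A \<subseteq> ?X \<and> D A \<in> p \<or> ?X - A \<subseteq> ?X \<and> D (?X - A) \<in> p"
      unfolding D_Diff using \<open>A \<subseteq> ?X\<close> ultrafilter_onD(6)[OF p D_sub] by blast
  qed (use iff D_carrier D_empty D_Int ultrafilter_onD(2-4)[OF p] in auto)
qed

text \<open>Both memberships unfold to one nested condition on triples \<open>s\<close>,
  \<open>t\<close>, \<open>u\<close>; associativity of \<open>M\<close> identifies the innermost
  sets.\<close>

lemma beta_assoc:
  assumes "is_semigroup M" and "ultrafilter_on (carrier M) p" and "ultrafilter_on (carrier M) q"
    and "ultrafilter_on (carrier M) r"
  shows "(p \<otimes>\<^bsub>beta M\<^esub> q) \<otimes>\<^bsub>beta M\<^esub> r = p \<otimes>\<^bsub>beta M\<^esub> (q \<otimes>\<^bsub>beta M\<^esub> r)"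
proof (rule Set.set_eqI)
  fix A
  let ?X = "carrier M"
  have eq: "{t \<in> ?X. s \<otimes>\<^bsub>M\<^esub> t \<in> {w \<in> ?X. {u \<in> ?X. w \<otimes>\<^bsub>M\<^esub> u \<in> A} \<in> r}} =
      {t \<in> ?X. {u \<in> ?X. t \<otimes>\<^bsub>M\<^esub> u \<in> {v \<in> ?X. s \<otimes>\<^bsub>M\<^esub> v \<in> A}} \<in> r}" if "s \<in> ?X" for s
  proof -
    have "{u \<in> ?X. (s \<otimes>\<^bsub>M\<^esub> t) \<otimes>\<^bsub>M\<^esub> u \<in> A} =
        {u \<in> ?X. t \<otimes>\<^bsub>M\<^esub> u \<in> {v \<in> ?X. s \<otimes>\<^bsub>M\<^esub> v \<in> A}}" if "t \<in> ?X" for t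
      using is_semigroupD(2,3)[OF assms(1)] \<open>s \<in> ?X\<close> that by auto
    then show ?thesis using is_semigroupD(2)[OF assms(1)] that by auto
  qed
  have "{s \<in> ?X. {t \<in> ?X. s \<otimes>\<^bsub>M\<^esub> t \<in> {w \<in> ?X. {u \<in> ?X. w \<otimes>\<^bsub>M\<^esub> u \<in> A} \<in> r}} \<in> q} =
      {s \<in> ?X. {v \<in> ?X. s \<otimes>\<^bsub>M\<^esub> v \<in> A} \<in> q \<otimes>\<^bsub>beta M\<^esub> r}"
    using eq unfolding beta_mult_iff by auto
  then show "A \<in> (p \<otimes>\<^bsub>beta M\<^esub> q) \<otimes>\<^bsub>beta M\<^esub> r \<longleftrightarrow> A \<in> p \<otimes>\<^bsub>beta M\<^esub> (q \<otimes>\<^bsub>beta M\<^esub> r)"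
    unfolding beta_mult_iff[of A] beta_mult_iff[of "{w \<in> ?X. _ w}"] by auto
qed

lemma is_semigroup_beta:
  assumes "is_semigroup M"
  shows "is_semigroup (beta M)"
proof -
  obtain x where "x \<in> carrier M" using is_semigroupD(1)[OF assms] by blast
  then have "principal_ultrafilter (carrier M) x \<in> carrier (beta M)"
    by (simp add: ultrafilter_on_principal)
  then show ?thesis
    unfolding is_semigroup_def using beta_mult_closed[OF assms] beta_assoc[OF assms] by auto
qed

lemma beta_mult_principal:
  assumes "is_semigroup M" and x: "x \<in> carrier M" and y: "y \<in> carrier M"
  shows "principal_ultrafilter (carrier M) x \<otimes>\<^bsub>beta M\<^esub> principal_ultrafilter (carrier M) y =
    principal_ultrafilter (carrier M) (x \<otimes>\<^bsub>M\<^esub> y)"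
  using assms by (auto simp: beta_mult_iff principal_ultrafilter_def)

lemma beta_carrier_finite:
  assumes "finite (carrier M)"
  shows "carrier (beta M) = embedded M"
proof (rule Set.set_eqI)
  fix p
  show "p \<in> carrier (beta M) \<longleftrightarrow> p \<in> embedded M"
    unfolding embedded_def beta_carrier_iff
    using ultrafilter_on_finite_principal[OF _ assms, of p] ultrafilter_on_principal[of _ "carrier M"]
    by (auto simp del: beta_carrier_iff)
qed

section \<open>Principal left ideals\<close>

lemma left_ideal_principal:
  assumes M: "is_semigroup M" and "q \<in> carrier M"
  shows "left_ideal M ((\<lambda>p. p \<otimes>\<^bsub>M\<^esub> q) ` carrier M)"
  unfolding left_ideal_def
proof (intro conjI ballI)
  fix s x assume "s \<in> carrier M" "x \<in> (\<lambda>p. p \<otimes>\<^bsub>M\<^esub> q) ` carrier M"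
  then obtain p where "p \<in> carrier M" "s \<otimes>\<^bsub>M\<^esub> x = (s \<otimes>\<^bsub>M\<^esub> p) \<otimes>\<^bsub>M\<^esub> q" "s \<otimes>\<^bsub>M\<^esub> p \<in> carrier M"
    using is_semigroupD(2,3)[OF M] assms(2) by force
  then show "s \<otimes>\<^bsub>M\<^esub> x \<in> (\<lambda>p. p \<otimes>\<^bsub>M\<^esub> q) ` carrier M" by blast
qed (use is_semigroupD[OF M] assms(2) in auto)

text \<open>The generator \<open>q\<close> may be any element of \<open>L\<close>, so it can later
  be chosen in \<open>Q\<close>.\<close>

lemma minimal_left_ideal_eq_principal:
  assumes M: "is_semigroup M" and L: "minimal_left_ideal M L" and "q \<in> L"
  shows "L = (\<lambda>p. p \<otimes>\<^bsub>M\<^esub> q) ` carrier M"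
proof -
  have "left_ideal M L" using L unfolding minimal_left_ideal_def by blast
  then have "q \<in> carrier M" "(\<lambda>p. p \<otimes>\<^bsub>M\<^esub> q) ` carrier M \<subseteq> L"
    using \<open>q \<in> L\<close> unfolding left_ideal_def by blast+
  with left_ideal_principal[OF M] L show ?thesis unfolding minimal_left_ideal_def by metis
qed

section \<open>Finite groups\<close>

text \<open>On a finite set the injective right translations are onto, so \<open>y a = b\<close> is
  always solvable for \<open>y\<close>. This yields an idempotent \<open>e\<close> and left
  inverses; common right multiples make \<open>e\<close> a left identity.\<close>

lemma finite_right_cancel_imp_group:
  assumes M: "is_semigroup M" and fin: "finite (carrier M)"
    and cancel: "\<And>x y z. x \<in> carrier M \<Longrightarrow> y \<in> carrier M \<Longrightarrow> z \<in> carrier M \<Longrightarrow>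
      x \<otimes>\<^bsub>M\<^esub> z = y \<otimes>\<^bsub>M\<^esub> z \<Longrightarrow> x = y"
    and common: "\<And>x y. x \<in> carrier M \<Longrightarrow> y \<in> carrier M \<Longrightarrow>
      \<exists>u\<in>carrier M. \<exists>v\<in>carrier M. x \<otimes>\<^bsub>M\<^esub> u = y \<otimes>\<^bsub>M\<^esub> v"
  shows "\<exists>e. group (M\<lparr>one := e\<rparr>)"
proof -
  note cl = is_semigroupD(2)[OF M] and assoc = is_semigroupD(3)[OF M]
  have solve: "\<exists>y\<in>carrier M. y \<otimes>\<^bsub>M\<^esub> a = b" if "a \<in> carrier M" "b \<in> carrier M" for a b
  proof -
    have "inj_on (\<lambda>y. y \<otimes>\<^bsub>M\<^esub> a) (carrier M)" using cancel that(1) by (auto intro: inj_onI)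
    then have "(\<lambda>y. y \<otimes>\<^bsub>M\<^esub> a) ` carrier M = carrier M"
      using cl that(1) by (intro endo_inj_surj[OF fin]) auto
    then have "b \<in> (\<lambda>y. y \<otimes>\<^bsub>M\<^esub> a) ` carrier M" using that(2) by simp
    then show ?thesis by blast
  qed
  obtain a where a: "a \<in> carrier M" using is_semigroupD(1)[OF M] by blast
  obtain e where e: "e \<in> carrier M" "e \<otimes>\<^bsub>M\<^esub> a = a" using solve[OF a a] by blast
  \<comment> \<open>\<open>(e e) a = e (e a) = e a\<close>, and \<open>a\<close> cancels.\<close>
  have ee: "e \<otimes>\<^bsub>M\<^esub> e = e" using cancel[of "e \<otimes>\<^bsub>M\<^esub> e" e a] cl assoc e a by metis
  have left_one: "e \<otimes>\<^bsub>M\<^esub> x = x" if x: "x \<in> carrier M" for x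
  proof -
    obtain u v where uv: "u \<in> carrier M" "v \<in> carrier M" "e \<otimes>\<^bsub>M\<^esub> u = x \<otimes>\<^bsub>M\<^esub> v"
      using common[OF e(1) x] by blast
    \<comment> \<open>\<open>e (x v) = e (e u) = e u = x v\<close>, using that \<open>e\<close> is
      idempotent.\<close>
    then have "(e \<otimes>\<^bsub>M\<^esub> x) \<otimes>\<^bsub>M\<^esub> v = x \<otimes>\<^bsub>M\<^esub> v" using assoc ee e(1) x by metis
    then show ?thesis using cancel cl e(1) x uv(2) by blast
  qed
  have "group (M\<lparr>one := e\<rparr>)"
    by (rule groupI) (use cl assoc left_one e(1) solve in auto)
  then show ?thesis ..
qed

text \<open>The quotient carries \<open>undefined\<close> in its field \<open>one\<close>, so being
  a group is expressed by the existence of some element to put there.\<close>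

locale finite_group_up_to_one =
  fixes T :: "('a, 'b) monoid_scheme"
  assumes fin: "finite (carrier T)" and ex_one: "\<exists>e. group (T\<lparr>one := e\<rparr>)"
begin

lemma is_semigroup: "is_semigroup T"
proof -
  obtain e where "group (T\<lparr>one := e\<rparr>)" using ex_one ..
  then interpret G: group "T\<lparr>one := e\<rparr>" .
  show ?thesis
    unfolding is_semigroup_def using G.m_closed G.m_assoc G.one_closed by auto
qed

lemma right_cancel:
  assumes "x \<in> carrier T" "y \<in> carrier T" "z \<in> carrier T" "x \<otimes>\<^bsub>T\<^esub> z = y \<otimes>\<^bsub>T\<^esub> z"
  shows "x = y"
proof -
  obtain e where "group (T\<lparr>one := e\<rparr>)" using ex_one ..
  then interpret G: group "T\<lparr>one := e\<rparr>" .
  show ?thesis using G.right_cancel[of z x y] assms by simp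
qed

lemma left_divide:
  assumes "x \<in> carrier T" "y \<in> carrier T"
  obtains z where "z \<in> carrier T" "x \<otimes>\<^bsub>T\<^esub> z = y"
proof -
  obtain e where "group (T\<lparr>one := e\<rparr>)" using ex_one ..
  then interpret G: group "T\<lparr>one := e\<rparr>" .
  have "inv\<^bsub>T\<lparr>one := e\<rparr>\<^esub> x \<otimes>\<^bsub>T\<^esub> y \<in> carrier T" "x \<otimes>\<^bsub>T\<^esub> (inv\<^bsub>T\<lparr>one := e\<rparr>\<^esub> x \<otimes>\<^bsub>T\<^esub> y) = y"
    using G.m_closed G.inv_closed G.m_assoc[symmetric] G.r_inv G.l_one assms by fastforce+
  then show thesis by (rule that)
qed

lemma right_divide:
  assumes "x \<in> carrier T" "y \<in> carrier T"
  obtains z where "z \<in> carrier T" "z \<otimes>\<^bsub>T\<^esub> x = y"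
proof -
  obtain e where "group (T\<lparr>one := e\<rparr>)" using ex_one ..
  then interpret G: group "T\<lparr>one := e\<rparr>" .
  have "y \<otimes>\<^bsub>T\<^esub> inv\<^bsub>T\<lparr>one := e\<rparr>\<^esub> x \<in> carrier T" "(y \<otimes>\<^bsub>T\<^esub> inv\<^bsub>T\<lparr>one := e\<rparr>\<^esub> x) \<otimes>\<^bsub>T\<^esub> x = y"
    using G.m_closed G.inv_closed G.m_assoc G.l_inv G.r_one assms by fastforce+
  then show thesis by (rule that)
qed

section \<open>Ideals of \<open>beta T\<close> for a finite group \<open>T\<close>\<close>

lemma left_ideal_beta_iff: "left_ideal (beta T) I \<longleftrightarrow> I = embedded T"
proof
  let ?\<epsilon> = "principal_ultrafilter (carrier T)"
  note beta_eq = beta_carrier_finite[OF fin]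
  assume I: "left_ideal (beta T) I"
  then obtain x where x: "x \<in> carrier T" "?\<epsilon> x \<in> I"
    unfolding left_ideal_def beta_eq embedded_def by blast
  \<comment> \<open>A group has no proper left ideal: every \<open>y\<close> is a left multiple
    \<open>z x\<close> of the given \<open>x\<close>.\<close>
  have "?\<epsilon> y \<in> I" if y: "y \<in> carrier T" for y
  proof -
    obtain z where z: "z \<in> carrier T" "z \<otimes>\<^bsub>T\<^esub> x = y" using right_divide[OF x(1) y] .
    then have "?\<epsilon> y = ?\<epsilon> z \<otimes>\<^bsub>beta T\<^esub> ?\<epsilon> x"
      using beta_mult_principal[OF is_semigroup] x by simp
    moreover have "?\<epsilon> z \<in> carrier (beta T)" using ultrafilter_on_principal[OF z(1)] by simp
    ultimately show ?thesis using I x(2) unfolding left_ideal_def by metis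
  qed
  then show "I = embedded T" using I unfolding left_ideal_def beta_eq embedded_def by blast
next
  assume "I = embedded T"
  then show "left_ideal (beta T) I"
    using is_semigroup_beta[OF is_semigroup] beta_carrier_finite[OF fin]
    unfolding left_ideal_def is_semigroup_def by blast
qed

lemma minimal_left_ideal_beta_iff: "minimal_left_ideal (beta T) L \<longleftrightarrow> L = embedded T"
  unfolding minimal_left_ideal_def left_ideal_beta_iff by auto

lemma smallest_ideal_beta: "is_smallest_ideal (beta T) (embedded T)"
proof -
  have "right_ideal (beta T) (embedded T)"
    using is_semigroup_beta[OF is_semigroup] beta_carrier_finite[OF fin]
    unfolding right_ideal_def is_semigroup_def by blast
  then show ?thesis
    unfolding is_smallest_ideal_def two_sided_ideal_def left_ideal_beta_iff by blast
qed

section \<open>Folner sets and density in a finite group\<close>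

lemma folner_set_carrier:
  assumes "H \<subseteq> carrier T" "\<epsilon> > 0"
  shows "folner_set T H \<epsilon> (carrier T)"
proof -
  have "carrier T \<noteq> {}" using is_semigroupD(1)[OF is_semigroup] .
  then have "card (carrier T) > 0" using fin by (simp add: card_gt_0_iff)
  \<comment> \<open>Left translations of a group are onto, so \<open>K = T\<close> loses no point
    and works for every \<epsilon>.\<close>
  moreover have "card (carrier T - (\<lambda>k. s \<otimes>\<^bsub>T\<^esub> k) ` carrier T) = 0" if "s \<in> H" for s
  proof -
    have "carrier T \<subseteq> (\<lambda>k. s \<otimes>\<^bsub>T\<^esub> k) ` carrier T"
      using left_divide[of s] assms(1) that by blast
    then have "carrier T - (\<lambda>k. s \<otimes>\<^bsub>T\<^esub> k) ` carrier T = {}" by blast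
    then show ?thesis by (simp only: card.empty)
  qed
  ultimately show ?thesis
    unfolding folner_set_def using fin assms(2) \<open>carrier T \<noteq> {}\<close>
    by (metis mult_pos_pos of_nat_0 of_nat_0_less_iff subset_refl)
qed

text \<open>The ratio of the sizes of \<open>A\<close> and \<open>T\<close> is an admissible
  density, witnessed by \<open>K = T\<close> for all \<open>H\<close> and \<epsilon> at once, and
  the supremum is at least this ratio.\<close>

lemma folner_density_pos:
  assumes "A \<subseteq> carrier T" "A \<noteq> {}"
  shows "folner_density T A > 0"
proof -
  define \<alpha> where "\<alpha> = card A / card (carrier T)"
  have A: "card A > 0" "card A \<le> card (carrier T)"
    using assms card_mono[OF fin] finite_subset[OF _ fin] by (auto simp: card_gt_0_iff)
  let ?D = "{\<alpha>::real. 0 \<le> \<alpha> \<and> \<alpha> \<le> 1 \<and>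
       (\<forall>H \<epsilon>. finite H \<and> H \<noteq> {} \<and> H \<subseteq> carrier T \<and> \<epsilon> > 0 \<longrightarrow>
          (\<exists>K. folner_set T H \<epsilon> K \<and> real (card (A \<inter> K)) \<ge> \<alpha> * real (card K)))}"
  have "real (card (A \<inter> carrier T)) \<ge> \<alpha> * real (card (carrier T))"
    using A assms(1) by (simp add: \<alpha>_def Int_absorb2)
  moreover have "0 < \<alpha>" "\<alpha> \<le> 1" using A by (auto simp: \<alpha>_def)
  ultimately have "\<alpha> \<in> ?D" using folner_set_carrier by fastforce
  \<comment> \<open>A real \<open>Sup\<close> dominates the members of its set when the set is
    bounded; the clause \<open>\<alpha> \<le> 1\<close> gives the bound.\<close>
  moreover have "bdd_above ?D" by (rule bdd_aboveI[of _ 1]) blast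
  ultimately have "\<alpha> \<le> Sup ?D" by (rule cSup_upper)
  then show ?thesis using \<open>0 < \<alpha>\<close> unfolding folner_density_def by linarith
qed

text \<open>Members of an ultrafilter are nonempty, hence of positive density, so
  \<open>Delta T\<close> is all of \<open>beta T\<close>.\<close>

lemma Delta_eq: "embedded T = Delta T"
proof -
  have "folner_density T A > 0" if "ultrafilter_on (carrier T) p" "A \<in> p" for p A
    using folner_density_pos ultrafilter_onD(1,3)[OF that(1)] that(2) by blast
  then show ?thesis unfolding Delta_def beta_carrier_finite[OF fin, symmetric] by auto
qed

end

section \<open>The cancellative quotient and ultrafilters\<close>

locale sfc_semigroup =
  fixes S :: "('a, 'b) monoid_scheme" (structure)
  assumes semi: "is_semigroup S" and sfc: "SFC S"
begin

abbreviation "R \<equiv> cancel_rel S"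
abbreviation "T \<equiv> cancel_quotient S"

lemmas cl = is_semigroupD(2)[OF semi]
lemmas assoc = is_semigroupD(3)[OF semi]
lemmas equiv_R = equiv_cancel_rel[OF semi sfc]

lemma carrier_T: "carrier T = carrier S // R"
  by (simp add: cancel_quotient_def)

lemma class_in_T: "a \<in> carrier S \<Longrightarrow> R `` {a} \<in> carrier T"
  by (simp add: carrier_T quotientI)

lemma in_T_obtain:
  assumes "C \<in> carrier T" obtains a where "a \<in> carrier S" "C = R `` {a}"
  using assms unfolding carrier_T by (rule quotientE)

lemma class_mult:
  "a \<in> carrier S \<Longrightarrow> b \<in> carrier S \<Longrightarrow> R `` {a} \<otimes>\<^bsub>T\<^esub> R `` {b} = R `` {a \<otimes> b}"
  using UN_equiv_class2[OF equiv_R equiv_R congruent2_cancel_rel[OF semi sfc]]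
  by (simp add: cancel_quotient_def)

lemma class_eq_iff:
  "a \<in> carrier S \<Longrightarrow> b \<in> carrier S \<Longrightarrow>
    R `` {a} = R `` {b} \<longleftrightarrow> (\<exists>x\<in>carrier S. a \<otimes> x = b \<otimes> x)"
  using eq_equiv_class_iff[OF equiv_R] by (auto simp: cancel_rel_def)

lemma class_self: "a \<in> carrier S \<Longrightarrow> a \<in> R `` {a}"
  using equiv_class_self[OF equiv_R] .

lemma class_eq: "C \<in> carrier T \<Longrightarrow> a \<in> C \<Longrightarrow> C = R `` {a}"
  using equiv_class_eq[OF equiv_R] unfolding carrier_T by (auto elim!: quotientE)

lemma class_sub: "C \<in> carrier T \<Longrightarrow> C \<subseteq> carrier S"
  unfolding carrier_T using Union_quotient[OF equiv_R] by blast

lemma semigroup_T: "is_semigroup T"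
  unfolding is_semigroup_def
proof (intro conjI ballI)
  show "carrier T \<noteq> {}" using is_semigroupD(1)[OF semi] class_in_T by blast
next
  fix A B assume "A \<in> carrier T" "B \<in> carrier T"
  then show "A \<otimes>\<^bsub>T\<^esub> B \<in> carrier T"
    by (elim in_T_obtain) (simp add: class_mult cl class_in_T)
next
  fix A B C assume "A \<in> carrier T" "B \<in> carrier T" "C \<in> carrier T"
  then show "A \<otimes>\<^bsub>T\<^esub> B \<otimes>\<^bsub>T\<^esub> C = A \<otimes>\<^bsub>T\<^esub> (B \<otimes>\<^bsub>T\<^esub> C)"
    by (elim in_T_obtain) (simp add: class_mult cl assoc)
qed

text \<open>If \<open>a c x = b c x\<close>, then \<open>c x\<close> witnesses that \<open>a\<close>
  and \<open>b\<close> are related, which gives right cancellation. Common right multiples pass from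
  \<open>S\<close> to the classes.\<close>

lemma finite_group_T:
  assumes "finite (carrier T)"
  shows "finite_group_up_to_one T"
proof (unfold_locales, rule assms, rule finite_right_cancel_imp_group[OF semigroup_T assms])
  fix A B C assume "A \<in> carrier T" "B \<in> carrier T" "C \<in> carrier T"
    and eq: "A \<otimes>\<^bsub>T\<^esub> C = B \<otimes>\<^bsub>T\<^esub> C"
  then obtain a b c where abc: "a \<in> carrier S" "b \<in> carrier S" "c \<in> carrier S"
    "A = R `` {a}" "B = R `` {b}" "C = R `` {c}" by (metis in_T_obtain)
  with eq obtain x where "x \<in> carrier S" "a \<otimes> c \<otimes> x = b \<otimes> c \<otimes> x"
    using class_eq_iff[of "a \<otimes> c" "b \<otimes> c"] by (auto simp: class_mult cl)
  then have "c \<otimes> x \<in> carrier S" "a \<otimes> (c \<otimes> x) = b \<otimes> (c \<otimes> x)" using abc by (simp_all add: assoc cl)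
  then show "A = B" using class_eq_iff abc by blast
next
  fix A B assume "A \<in> carrier T" "B \<in> carrier T"
  then obtain a b where ab: "a \<in> carrier S" "b \<in> carrier S" "A = R `` {a}" "B = R `` {b}"
    by (metis in_T_obtain)
  obtain u v where "u \<in> carrier S" "v \<in> carrier S" "a \<otimes> u = b \<otimes> v"
    using SFC_common_right_multiple[OF semi sfc ab(1,2)] .
  then show "\<exists>U\<in>carrier T. \<exists>V\<in>carrier T. A \<otimes>\<^bsub>T\<^esub> U = B \<otimes>\<^bsub>T\<^esub> V"
    using class_mult class_in_T ab by metis
qed

section \<open>Right ideals of \<open>S\<close> and the ultrafilters containing all of them\<close>

lemma right_ideal_carrier: "right_ideal S (carrier S)"
  unfolding right_ideal_def using is_semigroupD(1)[OF semi] cl by blast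

text \<open>The content is nonemptiness: a common right multiple of a point of \<open>I\<close> and
  a point of \<open>J\<close> lies in both. This makes the right ideals a filter base.\<close>

lemma right_ideal_Int:
  assumes "right_ideal S I" "right_ideal S J"
  shows "right_ideal S (I \<inter> J)"
proof -
  obtain a b where ab: "a \<in> I" "b \<in> J" "a \<in> carrier S" "b \<in> carrier S"
    using assms unfolding right_ideal_def by blast
  obtain u v where "u \<in> carrier S" "v \<in> carrier S" "a \<otimes> u = b \<otimes> v"
    using SFC_common_right_multiple[OF semi sfc ab(3,4)] .
  then have "a \<otimes> u \<in> I \<inter> J" using ab assms unfolding right_ideal_def by (metis IntI)
  then show ?thesis using assms unfolding right_ideal_def by blast
qed

text \<open>Nonempty precisely because \<open>a\<close> and \<open>b\<close> are related; closed
  under right multiplication by associativity.\<close>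

lemma right_ideal_equalizer:
  assumes "(a, b) \<in> R"
  shows "right_ideal S {x \<in> carrier S. a \<otimes> x = b \<otimes> x}"
proof -
  have ab: "a \<in> carrier S" "b \<in> carrier S" using assms by (auto simp: cancel_rel_def)
  have "a \<otimes> (x \<otimes> s) = b \<otimes> (x \<otimes> s)"
    if "x \<in> carrier S" "s \<in> carrier S" "a \<otimes> x = b \<otimes> x" for x s
    using assoc[of a x s] assoc[of b x s] ab that by simp
  then show ?thesis using assms cl by (auto simp: cancel_rel_def right_ideal_def)
qed

text \<open>Topologically, the intersection of the closures in \<open>beta S\<close> of all right
  ideals of \<open>S\<close>.\<close>

definition Q :: "'a set set set" where
  "Q = {q. ultrafilter_on (carrier S) q \<and> (\<forall>I. right_ideal S I \<longrightarrow> I \<in> q)}"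

lemma Q_sub: "Q \<subseteq> carrier (beta S)"
  by (auto simp: Q_def)

lemma Q_nonempty: "Q \<noteq> {}"
proof -
  let ?F = "{A. A \<subseteq> carrier S \<and> (\<exists>I. right_ideal S I \<and> I \<subseteq> A)}"
  have "filter_on (carrier S) ?F"
    unfolding filter_on_def
  proof (intro conjI ballI allI impI)
    show "carrier S \<in> ?F" using right_ideal_carrier by blast
    show "{} \<notin> ?F" unfolding right_ideal_def by blast
    fix A B assume "A \<in> ?F" "B \<in> ?F"
    then obtain I J where "right_ideal S I" "right_ideal S J" "I \<inter> J \<subseteq> A \<inter> B" "A \<subseteq> carrier S"
      by blast
    then show "A \<inter> B \<in> ?F" using right_ideal_Int by blast
  qed blast+
  then obtain q where "ultrafilter_on (carrier S) q" "?F \<subseteq> q"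
    by (rule filter_on_extends_to_ultrafilter)
  then have "q \<in> Q" unfolding Q_def right_ideal_def by blast
  then show ?thesis by blast
qed

text \<open>For \<open>s \<in> I\<close> all of \<open>S\<close> is sent into \<open>I\<close> by
  left multiplication with \<open>s\<close>, so the set testing \<open>I\<close> in the product
  contains \<open>I\<close>, which belongs to \<open>q\<close>.\<close>

lemma Q_mult:
  assumes q: "q \<in> Q" and p: "ultrafilter_on (carrier S) p"
  shows "q \<otimes>\<^bsub>beta S\<^esub> p \<in> Q"
proof -
  have qu: "ultrafilter_on (carrier S) q" using q unfolding Q_def by blast
  have "I \<in> q \<otimes>\<^bsub>beta S\<^esub> p" if I: "right_ideal S I" for I
  proof -
    have "{t \<in> carrier S. s \<otimes> t \<in> I} = carrier S" if "s \<in> I" for s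
      using I that unfolding right_ideal_def by blast
    then have "I \<subseteq> {s \<in> carrier S. {t \<in> carrier S. s \<otimes> t \<in> I} \<in> p}"
      using I ultrafilter_onD(2)[OF p] unfolding right_ideal_def by auto
    moreover have "I \<in> q" using q I unfolding Q_def by blast
    ultimately show ?thesis
      unfolding beta_mult_iff using ultrafilter_onD(5)[OF qu] I unfolding right_ideal_def by blast
  qed
  then show ?thesis unfolding Q_def using beta_mult_closed[OF semi qu p] by blast
qed

text \<open>For related \<open>s\<close> and \<open>s'\<close> the equalizer is in \<open>q\<close>,
  so \<open>s\<close> and \<open>s'\<close> are both in \<open>D A\<close> or both outside. Thus
  \<open>D A\<close> contains \<open>C\<close> or misses it, and every ultrafilter containing
  \<open>C\<close> decides \<open>D A\<close> in the same way.\<close>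

lemma mult_Q_cong:
  assumes C: "C \<in> carrier T" and u: "ultrafilter_on (carrier S) u" "C \<in> u"
    and v: "ultrafilter_on (carrier S) v" "C \<in> v" and q: "q \<in> Q"
  shows "u \<otimes>\<^bsub>beta S\<^esub> q = v \<otimes>\<^bsub>beta S\<^esub> q"
proof -
  have qu: "ultrafilter_on (carrier S) q" using q unfolding Q_def by blast
  define D where "D A = {s \<in> carrier S. {t \<in> carrier S. s \<otimes> t \<in> A} \<in> q}" for A
  have transfer: "s' \<in> D A" if s: "s \<in> C" "s' \<in> C" "s \<in> D A" for s s' A
  proof -
    let ?E = "{x \<in> carrier S. s \<otimes> x = s' \<otimes> x}"
    have "(s, s') \<in> R" using class_eq[OF C s(1)] s(2) by blast
    then have "?E \<in> q" using right_ideal_equalizer q unfolding Q_def by blast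
    moreover have "{t \<in> carrier S. s \<otimes> t \<in> A} \<in> q" using s(3) unfolding D_def by blast
    ultimately have "?E \<inter> {t \<in> carrier S. s \<otimes> t \<in> A} \<in> q" using ultrafilter_onD(4)[OF qu] by blast
    then have "{t \<in> carrier S. s' \<otimes> t \<in> A} \<in> q"
      by (rule ultrafilter_onD(5)[OF qu]) auto
    then show ?thesis unfolding D_def using class_sub[OF C] s(2) by blast
  qed
  have "D A \<in> w \<longleftrightarrow> C \<subseteq> D A" if w: "ultrafilter_on (carrier S) w" "C \<in> w" for A w
  proof
    assume "D A \<in> w"
    then have "D A \<inter> C \<noteq> {}" using ultrafilter_onD(3,4)[OF w(1)] w(2) by metis
    then show "C \<subseteq> D A" using transfer by blast
  next
    assume "C \<subseteq> D A"
    then show "D A \<in> w" by (rule ultrafilter_onD(5)[OF w]) (auto simp: D_def)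
  qed
  then have "D A \<in> u \<longleftrightarrow> D A \<in> v" for A using u v by blast
  then show ?thesis by (auto simp: beta_mult_iff D_def)
qed

end

section \<open>The homomorphism from \<open>beta S\<close> onto the finite quotient\<close>

locale sfc_finite_quotient = sfc_semigroup +
  assumes finite_T: "finite (carrier T)"
begin

sublocale T: finite_group_up_to_one T
  by (rule finite_group_T[OF finite_T])

text \<open>The continuous extension of \<open>S \<rightarrow> T\<close> to \<open>\<beta>S\<close>: the class that belongs to the ultrafilter,
  written without a choice operator.\<close>

definition cls :: "'a set set \<Rightarrow> 'a set" where
  "cls p = {s \<in> carrier S. R `` {s} \<in> p}"

text \<open>Two classes in one ultrafilter meet, hence coincide.\<close>

lemma cls_eqI:
  assumes p: "ultrafilter_on (carrier S) p" and C: "C \<in> carrier T" "C \<in> p"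
  shows "cls p = C"
proof
  show "C \<subseteq> cls p" using class_eq[OF C(1)] class_sub[OF C(1)] C(2) unfolding cls_def by auto
  show "cls p \<subseteq> C"
  proof
    fix s assume "s \<in> cls p"
    then have s: "s \<in> carrier S" "R `` {s} \<in> p" unfolding cls_def by auto
    then have "R `` {s} \<inter> C \<noteq> {}" using ultrafilter_onD(3,4)[OF p] C(2) by metis
    then obtain t where "t \<in> R `` {s}" "t \<in> C" by blast
    then have "R `` {s} = C" using class_eq[OF C(1)] class_eq[OF class_in_T[OF s(1)]] by metis
    then show "s \<in> C" using class_self[OF s(1)] by simp
  qed
qed

text \<open>The finitely many classes cover \<open>S\<close>, so one of them belongs to
  \<open>p\<close>.\<close>

lemma cls:
  assumes p: "ultrafilter_on (carrier S) p"
  shows "cls p \<in> carrier T" "cls p \<in> p"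
proof -
  have "\<Union>(carrier T) \<in> p"
    using Union_quotient[OF equiv_R] ultrafilter_onD(2)[OF p] by (simp add: carrier_T)
  then obtain C where "C \<in> carrier T" "C \<in> p"
    using ultrafilter_on_finite_Union[OF p finite_T] by blast
  with cls_eqI[OF p] show "cls p \<in> carrier T" "cls p \<in> p" by auto
qed

text \<open>Products of points of \<open>cls p\<close> and \<open>cls q\<close> fall into the
  product class, so that class belongs to the product ultrafilter and \<open>cls_eqI\<close>
  applies.\<close>

lemma cls_mult:
  assumes p: "ultrafilter_on (carrier S) p" and q: "ultrafilter_on (carrier S) q"
  shows "cls (p \<otimes>\<^bsub>beta S\<^esub> q) = cls p \<otimes>\<^bsub>T\<^esub> cls q"
proof (rule cls_eqI[OF beta_mult_closed[OF semi p q]])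
  let ?C = "cls p \<otimes>\<^bsub>T\<^esub> cls q"
  show CT: "?C \<in> carrier T" using is_semigroupD(2)[OF semigroup_T] cls p q by blast
  have "{t \<in> carrier S. s \<otimes> t \<in> ?C} \<in> q" if s: "s \<in> cls p" for s
  proof (rule ultrafilter_onD(5)[OF q cls(2)[OF q]])
    show "cls q \<subseteq> {t \<in> carrier S. s \<otimes> t \<in> ?C}"
    proof
      fix t assume t: "t \<in> cls q"
      have st: "s \<in> carrier S" "t \<in> carrier S" using s t cls(1) class_sub p q by blast+
      have "?C = R `` {s \<otimes> t}"
        using class_eq[OF cls(1)[OF p] s] class_eq[OF cls(1)[OF q] t] class_mult[OF st] by simp
      then show "t \<in> {t \<in> carrier S. s \<otimes> t \<in> ?C}" using class_self cl st by simp
    qed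
  qed auto
  then have "cls p \<subseteq> {s \<in> carrier S. {t \<in> carrier S. s \<otimes> t \<in> ?C} \<in> q}"
    using class_sub[OF cls(1)[OF p]] by blast
  then have "{s \<in> carrier S. {t \<in> carrier S. s \<otimes> t \<in> ?C} \<in> q} \<in> p"
    by (rule ultrafilter_onD(5)[OF p cls(2)[OF p]]) auto
  then show "?C \<in> p \<otimes>\<^bsub>beta S\<^esub> q" unfolding beta_mult_iff using class_sub[OF CT] by blast
qed

lemma cls_surj:
  assumes "C \<in> carrier T"
  obtains p where "ultrafilter_on (carrier S) p" "cls p = C"
proof -
  obtain a where a: "a \<in> carrier S" "C = R `` {a}" using assms by (rule in_T_obtain)
  let ?p = "principal_ultrafilter (carrier S) a"
  have "C \<in> ?p" using class_self[OF a(1)] class_sub[OF assms] a(2)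
    unfolding principal_ultrafilter_def by simp
  then show thesis
    using that ultrafilter_on_principal[OF a(1)] cls_eqI[OF _ assms] by blast
qed

lemma mult_Q_eqI:
  assumes "ultrafilter_on (carrier S) u" "ultrafilter_on (carrier S) v" "cls u = cls v" "q \<in> Q"
  shows "u \<otimes>\<^bsub>beta S\<^esub> q = v \<otimes>\<^bsub>beta S\<^esub> q"
  using mult_Q_cong[of "cls u" u v q] cls[OF assms(1)] cls[OF assms(2)] assms by simp

section \<open>Minimal left ideals of \<open>beta S\<close>\<close>

lemma minimal_left_ideal_Q:
  assumes q: "q \<in> Q"
  shows "minimal_left_ideal (beta S) ((\<lambda>p. p \<otimes>\<^bsub>beta S\<^esub> q) ` carrier (beta S))" (is "minimal_left_ideal _ ?L")
  unfolding minimal_left_ideal_def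
proof (intro conjI allI impI)
  have qu: "ultrafilter_on (carrier S) q" using q unfolding Q_def by blast
  show "left_ideal (beta S) ?L"
    using left_ideal_principal[OF is_semigroup_beta[OF semi]] qu by simp
  fix I assume I: "left_ideal (beta S) I \<and> I \<subseteq> ?L"
  then obtain u where u: "ultrafilter_on (carrier S) u" "u \<otimes>\<^bsub>beta S\<^esub> q \<in> I"
    unfolding left_ideal_def beta_carrier_iff[symmetric] by blast
  have "v \<otimes>\<^bsub>beta S\<^esub> q \<in> I" if v: "ultrafilter_on (carrier S) v" for v
  proof -
    \<comment> \<open>Division in \<open>T\<close> lifts to some \<open>w\<close> for which
      \<open>w u\<close> and \<open>v\<close> have the same class; they then agree after
      multiplication by \<open>q\<close>.\<close>
    obtain C where C: "C \<in> carrier T" "C \<otimes>\<^bsub>T\<^esub> cls u = cls v"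
      using T.right_divide[OF cls(1)[OF u(1)] cls(1)[OF v]] .
    obtain w where w: "ultrafilter_on (carrier S) w" "cls w = C" using cls_surj[OF C(1)] .
    have "v \<otimes>\<^bsub>beta S\<^esub> q = (w \<otimes>\<^bsub>beta S\<^esub> u) \<otimes>\<^bsub>beta S\<^esub> q"
      by (rule mult_Q_eqI[OF v _ _ q])
        (simp_all add: cls_mult w C u(1) beta_mult_closed[OF semi])
    also have "\<dots> = w \<otimes>\<^bsub>beta S\<^esub> (u \<otimes>\<^bsub>beta S\<^esub> q)" by (rule beta_assoc[OF semi w(1) u(1) qu])
    also have "\<dots> \<in> I" using I w(1) u(2) unfolding left_ideal_def by simp
    finally show ?thesis .
  qed
  then show "I = ?L" using I by auto
qed

text \<open>For \<open>p \<in> L\<close> and \<open>q \<in> Q\<close> the product \<open>q p\<close>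
  lies in \<open>L\<close> because \<open>L\<close> is a left ideal, and in \<open>Q\<close> by
  \<open>Q_mult\<close>; it generates \<open>L\<close>.\<close>

lemma minimal_left_ideal_obtain_Q:
  assumes L: "minimal_left_ideal (beta S) L"
  obtains q where "q \<in> Q" "L = (\<lambda>p. p \<otimes>\<^bsub>beta S\<^esub> q) ` carrier (beta S)"
proof -
  have LI: "left_ideal (beta S) L" using L unfolding minimal_left_ideal_def by blast
  then obtain p where p: "p \<in> L" "p \<in> carrier (beta S)" unfolding left_ideal_def by blast
  obtain q where q: "q \<in> Q" using Q_nonempty by blast
  have "q \<otimes>\<^bsub>beta S\<^esub> p \<in> L" using LI p(1) q Q_sub unfolding left_ideal_def by blast
  with that[of "q \<otimes>\<^bsub>beta S\<^esub> p"] show thesis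
    using Q_mult[OF q] p(2) minimal_left_ideal_eq_principal[OF is_semigroup_beta[OF semi] L]
    by simp
qed

text \<open>The isomorphism is \<open>cls\<close> restricted to \<open>L\<close>. Cancelling
  \<open>cls q\<close> in \<open>T\<close> gives injectivity, since \<open>u q\<close> is determined
  by \<open>cls u\<close>; dividing by \<open>cls q\<close> gives surjectivity.\<close>

lemma minimal_left_ideal_iso:
  assumes "minimal_left_ideal (beta S) L"
  shows "subsemigroup_on (beta S) L \<cong> T"
proof -
  obtain q where q: "q \<in> Q" and L: "L = (\<lambda>p. p \<otimes>\<^bsub>beta S\<^esub> q) ` carrier (beta S)"
    using minimal_left_ideal_obtain_Q[OF assms] .
  have qu: "ultrafilter_on (carrier S) q" using q unfolding Q_def by blast
  have sub: "ultrafilter_on (carrier S) p" if "p \<in> L" for p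
    using that beta_mult_closed[OF semi _ qu] unfolding L by auto
  have "inj_on cls L"
  proof (rule inj_onI)
    fix x y assume "x \<in> L" "y \<in> L" and eq: "cls x = cls y"
    then obtain u v where uv: "ultrafilter_on (carrier S) u" "x = u \<otimes>\<^bsub>beta S\<^esub> q"
      "ultrafilter_on (carrier S) v" "y = v \<otimes>\<^bsub>beta S\<^esub> q" unfolding L by auto
    then have "cls u \<otimes>\<^bsub>T\<^esub> cls q = cls v \<otimes>\<^bsub>T\<^esub> cls q" using eq cls_mult qu by simp
    then have "cls u = cls v" using T.right_cancel cls(1) uv(1,3) qu by blast
    then show "x = y" using mult_Q_eqI[OF uv(1,3) _ q] uv by simp
  qed
  moreover have "cls ` L = carrier T"
  proof
    show "cls ` L \<subseteq> carrier T" using sub cls(1) by blast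
    show "carrier T \<subseteq> cls ` L"
    proof
      fix C assume C: "C \<in> carrier T"
      obtain D where D: "D \<in> carrier T" "D \<otimes>\<^bsub>T\<^esub> cls q = C" using T.right_divide[OF cls(1)[OF qu] C] .
      obtain u where u: "ultrafilter_on (carrier S) u" "cls u = D" using cls_surj[OF D(1)] .
      have "cls (u \<otimes>\<^bsub>beta S\<^esub> q) = C" using cls_mult[OF u(1) qu] u(2) D(2) by simp
      then show "C \<in> cls ` L" unfolding L using u(1) by auto
    qed
  qed
  moreover have "cls (x \<otimes>\<^bsub>beta S\<^esub> y) = cls x \<otimes>\<^bsub>T\<^esub> cls y" if "x \<in> L" "y \<in> L" for x y
    using cls_mult sub that by blast
  ultimately have "cls \<in> iso (subsemigroup_on (beta S) L) T"
    unfolding iso_def hom_def bij_betw_def subsemigroup_on_def by auto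
  then show ?thesis unfolding is_iso_def by blast
qed

section \<open>The smallest right ideal of \<open>beta S\<close>\<close>

definition min_right :: "'a set set set" where
  "min_right = {p \<otimes>\<^bsub>beta S\<^esub> q | p q. ultrafilter_on (carrier S) p \<and> q \<in> Q}"

lemma right_ideal_min_right: "right_ideal (beta S) min_right"
  unfolding right_ideal_def
proof (intro conjI ballI)
  obtain q where "q \<in> Q" using Q_nonempty by blast
  then show "min_right \<noteq> {}" unfolding min_right_def Q_def by blast
  show "min_right \<subseteq> carrier (beta S)"
    unfolding min_right_def Q_def using beta_mult_closed[OF semi] by auto
  fix r x assume "r \<in> carrier (beta S)" "x \<in> min_right"
  then obtain p q where pq: "ultrafilter_on (carrier S) r" "ultrafilter_on (carrier S) p" "q \<in> Q"
    "x = p \<otimes>\<^bsub>beta S\<^esub> q" unfolding min_right_def by auto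
  then have "x \<otimes>\<^bsub>beta S\<^esub> r = p \<otimes>\<^bsub>beta S\<^esub> (q \<otimes>\<^bsub>beta S\<^esub> r)"
    using beta_assoc[OF semi] unfolding Q_def by blast
  then show "x \<otimes>\<^bsub>beta S\<^esub> r \<in> min_right" unfolding min_right_def using Q_mult pq by blast
qed

text \<open>Given \<open>y \<in> I\<close>, division in \<open>T\<close> yields \<open>w\<close>
  with \<open>y w\<close> in the class of \<open>p\<close>; then
  \<open>p q = (y w) q = y (w q)\<close> lies in \<open>I\<close>.\<close>

lemma min_right_subset:
  assumes I: "right_ideal (beta S) I"
  shows "min_right \<subseteq> I"
proof
  fix x assume "x \<in> min_right"
  then obtain p q where pq: "ultrafilter_on (carrier S) p" "q \<in> Q" "x = p \<otimes>\<^bsub>beta S\<^esub> q"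
    unfolding min_right_def by blast
  have qu: "ultrafilter_on (carrier S) q" using pq(2) unfolding Q_def by blast
  obtain y where y: "y \<in> I" "ultrafilter_on (carrier S) y" using I unfolding right_ideal_def beta_carrier_iff[symmetric] by blast
  obtain C where C: "C \<in> carrier T" "cls y \<otimes>\<^bsub>T\<^esub> C = cls p"
    using T.left_divide[OF cls(1)[OF y(2)] cls(1)[OF pq(1)]] .
  obtain w where w: "ultrafilter_on (carrier S) w" "cls w = C" using cls_surj[OF C(1)] .
  have "x = (y \<otimes>\<^bsub>beta S\<^esub> w) \<otimes>\<^bsub>beta S\<^esub> q"
    unfolding pq(3) by (rule mult_Q_eqI[OF pq(1) _ _ pq(2)])
      (simp_all add: cls_mult w C y(2) beta_mult_closed[OF semi])
  also have "\<dots> = y \<otimes>\<^bsub>beta S\<^esub> (w \<otimes>\<^bsub>beta S\<^esub> q)" by (rule beta_assoc[OF semi y(2) w(1) qu])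
  also have "\<dots> \<in> I" using I y(1) beta_mult_closed[OF semi w(1) qu] unfolding right_ideal_def by simp
  finally show "x \<in> I" .
qed

lemma unique_minimal_right_ideal: "\<exists>!I. minimal_right_ideal (beta S) I"
  using right_ideal_min_right min_right_subset unfolding minimal_right_ideal_def
  by (intro ex1I[of _ min_right]) blast+

end

theorem theorem3p14:
  fixes S :: "('a, 'b) monoid_scheme" and T :: "'a set monoid"
  assumes "is_semigroup S"
    and "SFC S"
    and "T = cancel_quotient S"
    and "finite (carrier T)"
  shows "(finite (carrier T) \<and> (\<exists>e. group (T\<lparr>one := e\<rparr>))) \<and>
         (\<forall>L. minimal_left_ideal (beta T) L \<longleftrightarrow> L = embedded T) \<and>
         ((\<exists>L. minimal_left_ideal (beta S) L) \<and>
          (\<forall>L. minimal_left_ideal (beta S) L \<longrightarrow> subsemigroup_on (beta S) L \<cong> T)) \<and>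
         (\<exists>!R. minimal_right_ideal (beta S) R) \<and>
         (is_smallest_ideal (beta T) (embedded T) \<and> embedded T = Delta T)"
proof -
  interpret sfc_finite_quotient S
    using assms by unfold_locales auto
  \<comment> \<open>Existence of a minimal left ideal of \<open>beta S\<close> comes from
    \<open>Q_nonempty\<close> with \<open>minimal_left_ideal_Q\<close>.\<close>
  show ?thesis
    unfolding assms(3)
    using T.fin T.ex_one T.minimal_left_ideal_beta_iff Q_nonempty minimal_left_ideal_Q
      minimal_left_ideal_iso unique_minimal_right_ideal T.smallest_ideal_beta T.Delta_eq
    by blast
qed

end
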